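(* Let $G$ be a countable group satisfying property RD with respect to a length function $\mathcal{L}$, and let $\mu$ be a non-degenerate probability measure on $G$ with finite Shannon entropy and finite $\log(1+\mathcal{L})$-moment, i.e.\ $\sum_{s}\mu(s)\log(1+\mathcal{L}(s))<\infty$. Let $(X,\xi)$ be a $(G,\mu)$-stationary space such that the Koopman representation $\pi_X$ is weakly contained in the left-regular representation $\lambda_G$. Then \[ h_\mu(X,\xi)=h(G,\mu)=-2\lim_{n\to\infty}\frac1n\sum_{s\in G}\mu^{*n}(s)\log\Xi_X(s). \]
   Context: $G$ is a countable discrete group; $\mu^{*n}$ is the $n$-fold convolution power of $\mu$ ($\mu*\nu(s)=\sum_t\mu(t)\nu(t^{-1}s)$). $\mu$ is non-degenerate if its support generates $G$ as a semigroup. Shannon entropy $H(G,\mu)=-\sum_s\mu(s)\log\mu(s)$; Avez entropy $h(G,\mu)=\lim_n\frac1nH(G,\mu^{*n})$. A length function satisfies $\mathcal{L}(e)=0$, $\mathcal{L}(s^{-1})=\mathcal{L}(s)$, $\mathcal{L}(st)\le\mathcal{L}(s)+\mathcal{L}(t)$. Property RD w.r.t.\ $\mathcal{L}$: for some $d\in\mathbb{N}$ the inclusion $\mathbb{C}[G]\hookrightarrow C^*_r(G)$ extends to a bounded map $\ell^2(G,\omega)\to C^*_r(G)$ with $\omega(s)=(1+\mathcal{L}(s))^d$, $\ell^2(G,\omega)=\{f:\sum|f|^2\omega^2<\infty\}$. A $(G,\mu)$-stationary space is a standard probability space $(X,\xi)$ with a measurable non-singular $G$-action such that $\sum_s\mu(s)\xi(s^{-1}A)=\xi(A)$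 for all measurable $A$. Write $\rho(s,x)=\frac{d(s^{-1}\xi)}{d\xi}(x)$, where $(s\xi)(A)=\xi(s^{-1}A)$. The Koopman representation $\pi_X$ on $L^2(X,\xi)$ is $[\pi_X(s)f](x)=\big[\frac{d(s\xi)}{d\xi}(x)\big]^{1/2}f(s^{-1}x)$, and $\Xi_X(s)=\langle\pi_X(s)1,1\rangle=\int_X\rho(s,x)^{1/2}d\xi(x)$. The Furstenberg entropy is $h_\mu(X,\xi)=-\sum_s\mu(s)\int_X\log\rho(s,x)\,d\xi(x)$. *)

theory Defs
  imports "HOL-Probability.Probability"
begin

(* The countable discrete group G is a type 'g of class group_add (written additively:
   identity 0, product s + t, inverse -s; commutativity is NOT assumed). *)

definition is_prob_measure :: "('g \<Rightarrow> real) \<Rightarrow> bool" where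
  "is_prob_measure mu \<longleftrightarrow> (\<forall>s. 0 \<le> mu s) \<and> (mu has_sum 1) UNIV"

definition conv :: "('g::group_add \<Rightarrow> real) \<Rightarrow> ('g \<Rightarrow> real) \<Rightarrow> 'g \<Rightarrow> real" where
  "conv mu nu s = (\<Sum>\<^sub>\<infinity>t. mu t * nu (- t + s))"

primrec conv_pow :: "('g::group_add \<Rightarrow> real) \<Rightarrow> nat \<Rightarrow> 'g \<Rightarrow> real" where
  "conv_pow mu 0 = (\<lambda>s. if s = 0 then 1 else 0)"
| "conv_pow mu (Suc n) = conv mu (conv_pow mu n)"

definition non_degenerate :: "('g::group_add \<Rightarrow> real) \<Rightarrow> bool" where
  "non_degenerate mu \<longleftrightarrow>
     (\<forall>s. \<exists>xs. xs \<noteq> [] \<and> set xs \<subseteq> {t. 0 < mu t} \<and> s = sum_list xs)"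

definition ent_term :: "real \<Rightarrow> real" where
  "ent_term p = (if p = 0 then 0 else - p * ln p)"

definition shannon_entropy :: "('g \<Rightarrow> real) \<Rightarrow> real" where
  "shannon_entropy mu = (\<Sum>\<^sub>\<infinity>s. ent_term (mu s))"

definition avez_entropy :: "('g::group_add \<Rightarrow> real) \<Rightarrow> real" where
  "avez_entropy mu = lim (\<lambda>n. shannon_entropy (conv_pow mu n) / real n)"

definition is_length_function :: "('g::group_add \<Rightarrow> real) \<Rightarrow> bool" where
  "is_length_function L \<longleftrightarrow> L 0 = 0 \<and> (\<forall>s. L (- s) = L s) \<and> (\<forall>s t. L (s + t) \<le> L s + L t)"

definition fin_supp :: "('g \<Rightarrow> complex) \<Rightarrow> bool" where
  "fin_supp f \<longleftrightarrow> finite {s. f s \<noteq> 0}"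

definition is_l2 :: "('g \<Rightarrow> complex) \<Rightarrow> bool" where
  "is_l2 phi \<longleftrightarrow> (\<lambda>s. (cmod (phi s))\<^sup>2) summable_on UNIV"

definition l2norm :: "('g \<Rightarrow> complex) \<Rightarrow> real" where
  "l2norm phi = sqrt (\<Sum>\<^sub>\<infinity>s. (cmod (phi s))\<^sup>2)"

definition lam :: "('g::group_add \<Rightarrow> complex) \<Rightarrow> ('g \<Rightarrow> complex) \<Rightarrow> 'g \<Rightarrow> complex" where
  "lam f phi t = (\<Sum>s\<in>{s. f s \<noteq> 0}. f s * phi (- s + t))"

(* the inclusion C[G] -> C*_r(G) extends to a bounded map l^2(G, omega) -> C*_r(G),
   omega(s) = (1 + L s)^d, i.e. ||lambda(f)|| <= C ||f omega||_2 for f in C[G] *)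
definition has_RD :: "('g::group_add \<Rightarrow> real) \<Rightarrow> bool" where
  "has_RD L \<longleftrightarrow> (\<exists>d::nat. \<exists>C::real. \<forall>f. fin_supp f \<longrightarrow>
      (\<forall>phi. is_l2 phi \<longrightarrow>
         l2norm (lam f phi) \<le> C * l2norm (\<lambda>s. f s * complex_of_real ((1 + L s) ^ d)) * l2norm phi))"

(* (X, xi) standard probability space: X a Polish space (type 'x) with its Borel sets;
   act a measurable, non-singular left action; xi is mu-stationary. *)
definition stationary_space ::
  "('g::group_add \<Rightarrow> real) \<Rightarrow> 'x::topological_space measure \<Rightarrow> ('g \<Rightarrow> 'x \<Rightarrow> 'x) \<Rightarrow> bool" where
  "stationary_space mu M act \<longleftrightarrow>
     prob_space M \<and> sets M = sets borel \<and>
     (\<forall>x. act 0 x = x) \<and> (\<forall>s t x. act (s + t) x = act s (act t x)) \<and>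
     (\<forall>s. act s \<in> M \<rightarrow>\<^sub>M M) \<and>
     (\<forall>s A. A \<in> sets M \<longrightarrow> emeasure M A = 0 \<longrightarrow> emeasure M (act s -` A \<inter> space M) = 0) \<and>
     (\<forall>A \<in> sets M. ((\<lambda>s. mu s * measure M (act s -` A \<inter> space M)) has_sum measure M A) UNIV)"

definition rho :: "'x measure \<Rightarrow> ('g::group_add \<Rightarrow> 'x \<Rightarrow> 'x) \<Rightarrow> 'g \<Rightarrow> 'x \<Rightarrow> real" where
  "rho M act s x = enn2real (RN_deriv M (distr M M (act (- s))) x)"

definition Xi :: "'x measure \<Rightarrow> ('g::group_add \<Rightarrow> 'x \<Rightarrow> 'x) \<Rightarrow> 'g \<Rightarrow> real" where
  "Xi M act s = (\<integral>x. sqrt (rho M act s x) \<partial>M)"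

definition furstenberg_entropy ::
  "('g::group_add \<Rightarrow> real) \<Rightarrow> 'x measure \<Rightarrow> ('g \<Rightarrow> 'x \<Rightarrow> 'x) \<Rightarrow> real" where
  "furstenberg_entropy mu M act = - (\<Sum>\<^sub>\<infinity>s. mu s * (\<integral>x. ln (rho M act s x) \<partial>M))"

definition is_L2 :: "'x measure \<Rightarrow> ('x \<Rightarrow> complex) \<Rightarrow> bool" where
  "is_L2 M g \<longleftrightarrow> g \<in> borel_measurable M \<and> integrable M (\<lambda>x. (cmod (g x))\<^sup>2)"

definition L2norm :: "'x measure \<Rightarrow> ('x \<Rightarrow> complex) \<Rightarrow> real" where
  "L2norm M g = sqrt (\<integral>x. (cmod (g x))\<^sup>2 \<partial>M)"

definition koopman :: "'x measure \<Rightarrow> ('g::group_add \<Rightarrow> 'x \<Rightarrow> 'x) \<Rightarrow> 'g \<Rightarrow> ('x \<Rightarrow> complex) \<Rightarrow> 'x \<Rightarrow> complex" where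
  "koopman M act s g x =
     complex_of_real (sqrt (enn2real (RN_deriv M (distr M M (act s)) x))) * g (act (- s) x)"

definition koopman_alg :: "'x measure \<Rightarrow> ('g::group_add \<Rightarrow> 'x \<Rightarrow> 'x) \<Rightarrow> ('g \<Rightarrow> complex) \<Rightarrow> ('x \<Rightarrow> complex) \<Rightarrow> 'x \<Rightarrow> complex" where
  "koopman_alg M act f g x = (\<Sum>s\<in>{s. f s \<noteq> 0}. f s * koopman M act s g x)"

(* pi_X weakly contained in lambda_G:  ||pi_X(f)|| <= ||lambda_G(f)|| for all f in C[G]
   (i.e. pi_X extends to a representation of C*_r(G)); operator norms written out as
   "every bound for lambda_G(f) is a bound for pi_X(f)". *)
definition weakly_contained_in_regular :: "'x measure \<Rightarrow> ('g::group_add \<Rightarrow> 'x \<Rightarrow> 'x) \<Rightarrow> bool" where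
  "weakly_contained_in_regular M act \<longleftrightarrow>
     (\<forall>f::'g \<Rightarrow> complex. fin_supp f \<longrightarrow> (\<forall>C::real.
        (\<forall>phi. is_l2 phi \<longrightarrow> l2norm (lam f phi) \<le> C * l2norm phi) \<longrightarrow>
        (\<forall>g. is_L2 M g \<longrightarrow> L2norm M (koopman_alg M act f g) \<le> C * L2norm M g)))"

end

theory Submission
  imports Defs
begin

text \<open>
  Put $I(s) = -\int \log\rho(s,x)\,d\xi(x)$. Stationarity gives $\rho(s,\cdot) \ge \mu^{*n}(s)$
  almost everywhere, so $0 \le I(s) \le -\log\mu^{*n}(s)$ on the support of $\mu^{*n}$, and the
  cocycle identity for $\rho$ gives $\sum_s \mu^{*n}(s) I(s) = n\,h_\mu(X,\xi)$. By Jensen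
  $-2\log\Xi_X \le I$, hence
  $-2\sum_s \mu^{*n}(s)\log\Xi_X(s) \le n\,h_\mu(X,\xi) \le H(G,\mu^{*n})$.

  Conversely, weak containment and property RD, tested on $\Xi_X\omega^{-2}$ restricted to finite
  sets and on the constant function $1$, show that $\Xi_X^2\omega^{-2}$ is summable. The Gibbs
  inequality against this weight bounds $H(G,\mu^{*n})$ by $-2\sum_s\mu^{*n}(s)\log\Xi_X(s)$ up to
  a constant plus a multiple of $\sum_s \mu^{*n}(s)\log(1+\mathcal{L}(s))$, which is $o(n)$.
  Dividing by $n$ squeezes all three quantities together; in particular the limit defining
  $h(G,\mu)$ exists without an appeal to subadditivity.
\<close>

subsection \<open>Convolution powers and entropy\<close>

lemma integrable_measure_pmf_iff_summable:
  fixes f :: "'a \<Rightarrow> real"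
  shows "integrable (measure_pmf p) f \<longleftrightarrow> (\<lambda>s. pmf p s * f s) summable_on UNIV"
proof -
  have "integrable (measure_pmf p) f \<longleftrightarrow> integrable (count_space UNIV) (\<lambda>s. pmf p s * f s)"
    unfolding measure_pmf_eq_density by (subst integrable_density) auto
  also have "\<dots> \<longleftrightarrow> (\<lambda>s. norm (pmf p s * f s)) summable_on UNIV"
    using abs_summable_equivalent[of "\<lambda>s. pmf p s * f s" UNIV] by (simp add: abs_summable_on_def)
  also have "\<dots> \<longleftrightarrow> (\<lambda>s. pmf p s * f s) summable_on UNIV"
    by (rule summable_on_iff_abs_summable_on_real[symmetric])
  finally show ?thesis .
qed

lemma expectation_pmf_eq_infsum:
  fixes f :: "'a \<Rightarrow> real"
  assumes "integrable (measure_pmf p) f"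
  shows "measure_pmf.expectation p f = (\<Sum>\<^sub>\<infinity>s. pmf p s * f s)"
proof -
  have "(\<lambda>s. norm (pmf p s * f s)) summable_on UNIV"
    using assms by (simp only: integrable_measure_pmf_iff_summable
        summable_on_iff_abs_summable_on_real[symmetric])
  then have "infsetsum (\<lambda>s. pmf p s * f s) UNIV = (\<Sum>\<^sub>\<infinity>s. pmf p s * f s)"
    by (intro infsetsum_infsum) (rule abs_summable_equivalent[THEN iffD1])
  then show ?thesis
    by (simp add: pmf_expectation_eq_infsetsum)
qed

lemma pmf_embed_is_prob_measure:
  assumes "is_prob_measure mu"
  shows "pmf (embed_pmf mu) = mu"
proof -
  have nn: "\<And>s. 0 \<le> mu s" and hs: "(mu has_sum 1) UNIV"
    using assms by (auto simp: is_prob_measure_def)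
  have "(\<lambda>s. norm (mu s)) summable_on UNIV"
    using has_sum_imp_summable[OF hs] nn by simp
  then have abs: "integrable (count_space UNIV) mu"
    using abs_summable_equivalent[of mu UNIV] by (simp add: abs_summable_on_def)
  have "infsetsum mu UNIV = infsum mu UNIV"
    by (intro infsetsum_infsum) (use abs in \<open>simp add: abs_summable_on_def\<close>)
  also have "\<dots> = 1" using hs by (rule infsumI)
  finally have "(\<integral>\<^sup>+s. ennreal (mu s) \<partial>count_space UNIV) = 1"
    using nn_integral_eq_integral[OF abs] nn by (simp add: infsetsum_def)
  then show ?thesis
    using nn by (intro ext pmf_embed_pmf) auto
qed

section \<open>Convolution as the law of a product of independent elements\<close>

definition convol_pmf :: "'g::group_add pmf \<Rightarrow> 'g pmf \<Rightarrow> 'g pmf" where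
  "convol_pmf p q = map_pmf (\<lambda>(s, t). s + t) (pair_pmf p q)"

primrec convol_pow_pmf :: "'g::group_add pmf \<Rightarrow> nat \<Rightarrow> 'g pmf" where
  "convol_pow_pmf p 0 = return_pmf 0"
| "convol_pow_pmf p (Suc n) = convol_pmf p (convol_pow_pmf p n)"

lemma nn_integral_convol_pmf:
  "(\<integral>\<^sup>+s. f s \<partial>convol_pmf p q) = (\<integral>\<^sup>+t. \<integral>\<^sup>+u. f (t + u) \<partial>q \<partial>p)"
  by (simp add: convol_pmf_def nn_integral_pair_pmf')

lemma set_convol_pmf: "t \<in> set_pmf p \<Longrightarrow> u \<in> set_pmf q \<Longrightarrow> t + u \<in> set_pmf (convol_pmf p q)"
  by (force simp: convol_pmf_def)

lemma pmf_convol_ge: "pmf p t * pmf q u \<le> pmf (convol_pmf p q) (t + u)"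
proof -
  have "pmf p t * pmf q u = measure (pair_pmf p q) {(t, u)}"
    by (simp add: pmf_pair measure_pmf_single)
  also have "\<dots> \<le> measure (pair_pmf p q) ((\<lambda>(s, t). s + t) -` {t + u})"
    by (intro measure_pmf.finite_measure_mono) auto
  finally show ?thesis by (simp add: convol_pmf_def pmf_map)
qed

lemma pmf_convol: "pmf (convol_pmf p q) = conv (pmf p) (pmf q)"
proof
  fix s
  have "convol_pmf p q = bind_pmf p (\<lambda>t. map_pmf ((+) t) q)"
    by (simp add: convol_pmf_def pair_pmf_def map_bind_pmf map_pmf_def bind_assoc_pmf bind_return_pmf)
  moreover have "pmf (map_pmf ((+) t) q) s = pmf q (- t + s)" for t
    using pmf_map_inj'[of "(+) t" q "- t + s"] by (simp add: add.assoc[symmetric])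
  ultimately have "pmf (convol_pmf p q) s = (\<integral>t. pmf q (- t + s) \<partial>p)"
    by (simp add: pmf_bind)
  also have "(\<integral>t. pmf q (- t + s) \<partial>p) = (\<Sum>\<^sub>\<infinity>t. pmf p t * pmf q (- t + s))"
    by (intro expectation_pmf_eq_infsum measure_pmf.integrable_const_bound[where B=1])
       (auto simp: pmf_le_1)
  finally show "pmf (convol_pmf p q) s = conv (pmf p) (pmf q) s" by (simp add: conv_def)
qed

lemma pmf_convol_pow: "pmf (convol_pow_pmf p n) = conv_pow (pmf p) n"
  by (induction n) (auto simp: pmf_convol pmf_return indicator_def)

text \<open>Extended values allow subadditivity to be stated before finiteness is known. Since
  \<open>- ln (pmf p s)\<close> is never negative, \<open>ennreal\<close> truncates nothing.\<close>

definition nn_entropy :: "'a pmf \<Rightarrow> ennreal" where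
  "nn_entropy p = (\<integral>\<^sup>+s. ennreal (- ln (pmf p s)) \<partial>p)"

text \<open>A pair \<open>(t, u)\<close> contributes at least \<open>pmf p t * pmf q u\<close> to
  the mass at \<open>t + u\<close>, so the information content of a product is at most the sum of
  the contents of its factors. Integrating over independent \<open>t\<close> and \<open>u\<close>
  gives the claim.\<close>

lemma nn_entropy_convol_pmf: "nn_entropy (convol_pmf p q) \<le> nn_entropy p + nn_entropy q"
proof -
  have le: "- ln (pmf (convol_pmf p q) (t + u)) \<le> - ln (pmf p t) + - ln (pmf q u)"
    if "t \<in> set_pmf p" "u \<in> set_pmf q" for t u
  proof -
    have pos: "0 < pmf p t" "0 < pmf q u" using that by (auto simp: pmf_positive)
    have "ln (pmf p t * pmf q u) \<le> ln (pmf (convol_pmf p q) (t + u))"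
      using pos pmf_convol_ge[of p t q u]
      by (subst ln_le_cancel_iff) (auto intro: order.strict_trans2[OF _ pmf_convol_ge])
    then show ?thesis using pos by (simp add: ln_mult)
  qed
  have "nn_entropy (convol_pmf p q)
      \<le> (\<integral>\<^sup>+t. \<integral>\<^sup>+u. ennreal (- ln (pmf p t)) + ennreal (- ln (pmf q u)) \<partial>q \<partial>p)"
    unfolding nn_entropy_def nn_integral_convol_pmf
  proof (intro nn_integral_mono_AE AE_pmfI)
    fix t u assume "t \<in> set_pmf p" "u \<in> set_pmf q"
    then show "ennreal (- ln (pmf (convol_pmf p q) (t + u)))
        \<le> ennreal (- ln (pmf p t)) + ennreal (- ln (pmf q u))"
      using le[of t u] by (subst ennreal_plus[symmetric])
        (auto simp: pmf_le_1 pmf_positive intro!: ennreal_leI)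
  qed
  also have "\<dots> = nn_entropy p + nn_entropy q"
    by (simp add: nn_integral_add nn_entropy_def)
  finally show ?thesis .
qed

lemma nn_entropy_convol_pow_pmf: "nn_entropy p < \<infinity> \<Longrightarrow> nn_entropy (convol_pow_pmf p n) < \<infinity>"
proof (induction n)
  case 0
  then show ?case by (simp add: nn_entropy_def)
next
  case (Suc n)
  then have "nn_entropy p + nn_entropy (convol_pow_pmf p n) < \<infinity>"
    by (simp add: less_top[symmetric])
  then show ?case
    using nn_entropy_convol_pmf[of p "convol_pow_pmf p n"]
    by (simp add: order.strict_trans1)
qed

lemma ent_term_pmf: "ent_term (pmf p s) = pmf p s * (- ln (pmf p s))"
  by (simp add: ent_term_def)

text \<open>Off the support this rests on the convention \<open>ln 0 = 0\<close>, so no support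
  condition has to be carried.\<close>

lemma ln_pmf_nonpos: "ln (pmf p s) \<le> 0"
  by (metis ln_0 ln_le_zero_iff order_refl pmf_le_1 pmf_nonneg order_le_less)

lemma integrable_ln_pmf_iff: "integrable (measure_pmf p) (\<lambda>s. - ln (pmf p s)) \<longleftrightarrow> nn_entropy p < \<infinity>"
  unfolding integrable_iff_bounded nn_entropy_def by (simp add: ln_pmf_nonpos)

lemma shannon_entropy_pmf:
  "nn_entropy p < \<infinity> \<Longrightarrow> shannon_entropy (pmf p) = measure_pmf.expectation p (\<lambda>s. - ln (pmf p s))"
  unfolding shannon_entropy_def ent_term_pmf
  by (subst expectation_pmf_eq_infsum) (auto simp only: integrable_ln_pmf_iff)

lemma nn_entropy_finite_iff:
  "nn_entropy p < \<infinity> \<longleftrightarrow> (\<lambda>s. ent_term (pmf p s)) summable_on UNIV"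
  unfolding ent_term_pmf integrable_ln_pmf_iff[symmetric] integrable_measure_pmf_iff_summable ..

text \<open>The inequality \<open>ln r \<le> r - 1\<close> is integrated with
  \<open>r = q / (K * pmf p)\<close>. The bound on finite sums makes \<open>q / K\<close> a
  subprobability, so \<open>r\<close> has mean at most 1 under \<open>p\<close> and the right-hand
  side integrates to at most 0.\<close>

lemma gibbs_subprobability:
  fixes q :: "'a \<Rightarrow> real"
  assumes fin: "nn_entropy p < \<infinity>"
    and int: "integrable (measure_pmf p) (\<lambda>s. ln (q s))"
    and nn: "\<And>s. 0 \<le> q s" and pos: "\<And>s. s \<in> set_pmf p \<Longrightarrow> 0 < q s" and K: "0 < K"
    and sum: "\<And>F. finite F \<Longrightarrow> sum q F \<le> K"
  shows "measure_pmf.expectation p (\<lambda>s. - ln (pmf p s))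
      \<le> measure_pmf.expectation p (\<lambda>s. - ln (q s)) + ln K"
proof -
  let ?r = "\<lambda>s. q s / (K * pmf p s)"
  have "(\<lambda>s. q s / K) summable_on UNIV"
    by (intro nonneg_bdd_above_summable_on bdd_aboveI[where M=1])
       (use nn K sum in \<open>auto simp: sum_divide_distrib[symmetric] less_imp_le\<close>)
  moreover have "(\<Sum>\<^sub>\<infinity>s. q s / K) \<le> 1"
    by (intro infsum_le_finite_sums calculation)
       (use K sum in \<open>auto simp: sum_divide_distrib[symmetric]\<close>)
  \<comment> \<open>Only an inequality: where \<open>pmf p s\<close> is 0 the left side vanishes,
    while \<open>q s\<close> may be positive.\<close>
  moreover have le: "pmf p s * ?r s \<le> q s / K" "0 \<le> pmf p s * ?r s" for s
    using nn[of s] K by (auto simp: field_simps)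
  ultimately have sr: "(\<lambda>s. pmf p s * ?r s) summable_on UNIV"
      and r1: "(\<Sum>\<^sub>\<infinity>s. pmf p s * ?r s) \<le> 1"
    by (auto intro: summable_on_comparison_test order_trans[OF infsum_mono])
  have ir: "integrable (measure_pmf p) ?r"
    using sr by (simp add: integrable_measure_pmf_iff_summable)
  have il: "integrable (measure_pmf p) (\<lambda>s. - ln (pmf p s))"
    using fin by (simp only: integrable_ln_pmf_iff)
  have "measure_pmf.expectation p (\<lambda>s. - ln (pmf p s) + ln (q s) - ln K)
      \<le> measure_pmf.expectation p (\<lambda>s. ?r s - 1)"
  proof (intro integral_mono_AE AE_pmfI)
    fix s assume s: "s \<in> set_pmf p"
    then have "0 < pmf p s" by (rule pmf_positive)
    then show "- ln (pmf p s) + ln (q s) - ln K \<le> ?r s - 1"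
      using pos[OF s] K ln_le_minus_one[of "?r s"] by (simp add: ln_div ln_mult)
  qed (use il int ir in auto)
  also have "\<dots> \<le> 0"
    using ir r1 by (simp add: expectation_pmf_eq_infsum)
  finally show ?thesis
    using il int by simp
qed

subsection \<open>Sublinear growth of the logarithmic moment\<close>

lemma length_function_nonneg:
  assumes "is_length_function L"
  shows "0 \<le> L s"
proof -
  have "L (s + - s) \<le> L s + L (- s)" "L (- s) = L s" "L 0 = 0"
    using assms unfolding is_length_function_def by blast+
  then show ?thesis by simp
qed

text \<open>
  Steps of length at most $K$ contribute to the argument of the logarithm, longer ones are split
  off by $1 + a + b \le (1+a)(1+b)$; the offset $a$ makes the induction on $n$ go through.
\<close>
lemma moment_convol_pow_pmf:
  fixes L :: "'g::group_add \<Rightarrow> real"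
  assumes sub: "\<And>s t. L (s + t) \<le> L s + L t" and nn: "\<And>s. 0 \<le> L s" and L0: "L 0 = 0"
    and "0 \<le> a" "0 \<le> K"
  shows "(\<integral>\<^sup>+s. ennreal (ln (1 + a + L s)) \<partial>convol_pow_pmf p n)
      \<le> ennreal (ln (1 + a + real n * K))
        + of_nat n * (\<integral>\<^sup>+s. ennreal (if L s \<le> K then 0 else ln (1 + L s)) \<partial>p)"
    (is "_ \<le> _ + _ * ?e")
  using \<open>0 \<le> a\<close>
proof (induction n arbitrary: a)
  case 0
  then show ?case using L0 by simp
next
  case (Suc n)
  let ?b = "ennreal (ln (1 + a + real (Suc n) * K)) + of_nat n * ?e"
  let ?g = "\<lambda>t. ennreal (if L t \<le> K then 0 else ln (1 + L t))"
  have "(\<integral>\<^sup>+u. ennreal (ln (1 + a + L (t + u))) \<partial>convol_pow_pmf p n) \<le> ?b + ?g t" for t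
  proof (cases "L t \<le> K")
    case True
    have "(\<integral>\<^sup>+u. ennreal (ln (1 + a + L (t + u))) \<partial>convol_pow_pmf p n)
        \<le> (\<integral>\<^sup>+u. ennreal (ln (1 + (a + K) + L u)) \<partial>convol_pow_pmf p n)"
    proof (intro nn_integral_mono ennreal_leI)
      fix u show "ln (1 + a + L (t + u)) \<le> ln (1 + (a + K) + L u)"
        using Suc.prems nn[of "t + u"] nn[of u] sub[of t u] True \<open>0 \<le> K\<close>
        by (subst ln_le_cancel_iff) auto
    qed
    also have "\<dots> \<le> ennreal (ln (1 + (a + K) + real n * K)) + of_nat n * ?e"
      using Suc.prems \<open>0 \<le> K\<close> by (intro Suc.IH) auto
    also have "\<dots> = ?b" by (simp add: algebra_simps)
    finally show ?thesis using True by simp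
  next
    case False
    have "(\<integral>\<^sup>+u. ennreal (ln (1 + a + L (t + u))) \<partial>convol_pow_pmf p n)
        \<le> (\<integral>\<^sup>+u. ennreal (ln (1 + L t)) + ennreal (ln (1 + a + L u)) \<partial>convol_pow_pmf p n)"
    proof (intro nn_integral_mono)
      fix u
      have "1 + a + L (t + u) \<le> (1 + L t) * (1 + a + L u)"
        using sub[of t u] mult_nonneg_nonneg[OF nn[of t] add_nonneg_nonneg[OF Suc.prems nn[of u]]]
        by (simp add: algebra_simps)
      then have "ln (1 + a + L (t + u)) \<le> ln ((1 + L t) * (1 + a + L u))"
        using Suc.prems nn[of "t + u"] nn[of u] nn[of t]
        by (subst ln_le_cancel_iff) (auto intro!: mult_pos_pos add_pos_nonneg)
      also have "\<dots> = ln (1 + L t) + ln (1 + a + L u)"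
        using Suc.prems nn[of u] nn[of t] by (subst ln_mult) auto
      finally show "ennreal (ln (1 + a + L (t + u))) \<le> ennreal (ln (1 + L t)) + ennreal (ln (1 + a + L u))"
        using Suc.prems nn[of u] nn[of t] by (subst ennreal_plus[symmetric]) (auto simp del: ennreal_plus intro: ennreal_leI)
    qed
    also have "\<dots> = ennreal (ln (1 + L t)) + (\<integral>\<^sup>+u. ennreal (ln (1 + a + L u)) \<partial>convol_pow_pmf p n)"
      by (simp add: nn_integral_add)
    also have "\<dots> \<le> ennreal (ln (1 + L t)) + (ennreal (ln (1 + a + real n * K)) + of_nat n * ?e)"
      using Suc by (intro add_left_mono) auto
    also have "ln (1 + a + real n * K) \<le> ln (1 + a + real (Suc n) * K)"
      using Suc.prems \<open>0 \<le> K\<close> by (subst ln_le_cancel_iff) (auto intro!: add_pos_nonneg mult_right_mono)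
    finally show ?thesis
      using False by (simp add: add_ac ennreal_leI add_left_mono add_right_mono)
  qed
  then have "(\<integral>\<^sup>+s. ennreal (ln (1 + a + L s)) \<partial>convol_pow_pmf p (Suc n)) \<le> (\<integral>\<^sup>+t. ?b + ?g t \<partial>p)"
    by (simp add: nn_integral_convol_pmf nn_integral_mono)
  also have "\<dots> = ?b + ?e" by (simp add: nn_integral_add)
  finally show ?case by (simp add: algebra_simps)
qed

text \<open>For a fixed cutoff \<open>k\<close> the preceding estimate is a logarithm in
  \<open>n\<close> plus \<open>n\<close> times the expectation of the tail beyond \<open>k\<close>.
  Division by \<open>n\<close> kills the logarithm, and the tail is small for large \<open>k\<close>
  because the logarithmic moment is finite.\<close>

lemma log_moment_convol_pow_pmf:
  fixes L :: "'g::group_add \<Rightarrow> real"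
  assumes L: "is_length_function L"
    and int: "integrable (measure_pmf p) (\<lambda>s. ln (1 + L s))"
  shows "integrable (measure_pmf (convol_pow_pmf p n)) (\<lambda>s. ln (1 + L s))"
    and "(\<lambda>n. measure_pmf.expectation (convol_pow_pmf p n) (\<lambda>s. ln (1 + L s)) / real n) \<longlonglongrightarrow> 0"
proof -
  note nn = length_function_nonneg[OF L]
  have sub: "L (s + t) \<le> L s + L t" and L0: "L 0 = 0" for s t
    using L by (auto simp: is_length_function_def)
  define g where "g k s = (if L s \<le> k then 0 else ln (1 + L s))" for k s
  have g_nn: "0 \<le> g k s" for k s using nn[of s] by (simp add: g_def)
  have ig: "integrable (measure_pmf p) (g k)" for k
    by (rule Bochner_Integration.integrable_bound[OF int]) (auto simp: g_def)
  have le: "(\<integral>\<^sup>+s. ennreal (ln (1 + L s)) \<partial>convol_pow_pmf p n)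
      \<le> ennreal (ln (1 + real n * k) + real n * measure_pmf.expectation p (g k))" if "0 \<le> k" for n k
  proof -
    have "(\<integral>\<^sup>+s. ennreal (g k s) \<partial>p) = ennreal (measure_pmf.expectation p (g k))"
      by (intro nn_integral_eq_integral ig AE_I2 g_nn)
    moreover have "0 \<le> measure_pmf.expectation p (g k)"
      by (intro integral_nonneg_AE AE_I2 g_nn)
    ultimately show ?thesis
      using moment_convol_pow_pmf[OF sub nn L0 order_refl that, where n=n and p=p] that
      by (simp add: g_def[symmetric] ennreal_mult ennreal_of_nat_eq_real_of_nat)
  qed
  \<comment> \<open>For each fixed \<open>n\<close> the cutoff 0 already gives a finite
    bound.\<close>
  show int_pow: "integrable (measure_pmf (convol_pow_pmf p n)) (\<lambda>s. ln (1 + L s))" for n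
    using le[of 0 n] nn unfolding integrable_iff_bounded
    by (auto simp: order.strict_trans1[OF _ ennreal_less_top])
  define l where "l n = measure_pmf.expectation (convol_pow_pmf p n) (\<lambda>s. ln (1 + L s))" for n
  have l_nn: "0 \<le> l n" for n
    unfolding l_def using nn by (intro integral_nonneg_AE AE_I2) simp
  have l_le: "l n \<le> ln (1 + real n * k) + real n * measure_pmf.expectation p (g k)" if "0 \<le> k" for n k
  proof -
    have "0 \<le> measure_pmf.expectation p (g k)"
      by (intro integral_nonneg_AE AE_I2 g_nn)
    moreover have "(\<integral>\<^sup>+s. ennreal (ln (1 + L s)) \<partial>convol_pow_pmf p n) = ennreal (l n)"
      unfolding l_def using int_pow[of n] nn by (intro nn_integral_eq_integral) auto
    ultimately show ?thesis
      using le[OF that, of n] that by (simp del: ennreal_plus)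
  qed
  have g_lim: "(\<lambda>k. measure_pmf.expectation p (g (real k))) \<longlonglongrightarrow> measure_pmf.expectation p (\<lambda>_. 0)"
  proof (rule integral_dominated_convergence[OF _ _ int])
    show "AE s in measure_pmf p. (\<lambda>k. g (real k) s) \<longlonglongrightarrow> 0"
    proof (rule AE_I2)
      fix s
      obtain k0 :: nat where "L s \<le> real k0" using real_arch_simple by blast
      then have "\<forall>\<^sub>F k in sequentially. g (real k) s = 0"
        by (intro eventually_sequentiallyI[of k0]) (simp add: g_def)
      then show "(\<lambda>k. g (real k) s) \<longlonglongrightarrow> 0" by (rule tendsto_eventually)
    qed
    show "AE s in measure_pmf p. norm (g (real k) s) \<le> ln (1 + L s)" for k
      using nn by (intro AE_I2) (auto simp: g_def)
  qed simp_all
  show "(\<lambda>n. measure_pmf.expectation (convol_pow_pmf p n) (\<lambda>s. ln (1 + L s)) / real n) \<longlonglongrightarrow> 0"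
    unfolding l_def[symmetric]
  proof (rule LIMSEQ_I)
    fix e :: real assume e: "0 < e"
    \<comment> \<open>The cutoff is fixed first, spending half of \<open>e\<close> on the tail; only
      then is \<open>n\<close> taken large.\<close>
    obtain k :: nat where k: "measure_pmf.expectation p (g (real k)) < e / 2"
      using order_tendstoD(2)[OF g_lim, of "e / 2"] e by (auto simp: eventually_sequentially)
    have "(\<lambda>n. ln (1 + real k) * (1 / real n) + ln (real n) / real n) \<longlonglongrightarrow> ln (1 + real k) * 0 + 0"
      by (intro tendsto_intros lim_1_over_n lim_ln_over_n)
    then have "\<forall>\<^sub>F n in sequentially. ln (1 + real k) * (1 / real n) + ln (real n) / real n < e / 2"
      using e by (intro order_tendstoD(2)) auto
    then obtain N where N: "\<And>n. N \<le> n \<Longrightarrow> ln (1 + real k) * (1 / real n) + ln (real n) / real n < e / 2"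
      by (auto simp: eventually_sequentially)
    have "norm (l n / real n - 0) < e" if n: "max 1 N \<le> n" for n
    proof -
      \<comment> \<open>For \<open>n \<ge> 1\<close> this splits the logarithm into a constant and
        \<open>ln (real n)\<close>, both negligible against \<open>n\<close>.\<close>
      have "1 + real n * real k \<le> (1 + real k) * real n"
        using n by (simp add: algebra_simps)
      then have "ln (1 + real n * real k) \<le> ln ((1 + real k) * real n)"
        using n by (subst ln_le_cancel_iff) (auto intro: add_pos_nonneg)
      also have "\<dots> = ln (1 + real k) + ln (real n)" using n by (subst ln_mult) auto
      finally have "l n \<le> ln (1 + real k) + ln (real n) + real n * measure_pmf.expectation p (g (real k))"
        using l_le[of "real k" n] by simp
      then have "l n / real n \<le> ln (1 + real k) * (1 / real n) + ln (real n) / real n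
          + measure_pmf.expectation p (g (real k))"
        using n by (simp add: field_simps)
      also have "\<dots> < e / 2 + e / 2" using n by (intro add_strict_mono N k) simp
      finally show ?thesis using l_nn[of n] by simp
    qed
    then show "\<exists>N. \<forall>n\<ge>N. norm (l n / real n - 0) < e" by blast
  qed
qed

subsection \<open>Non-singular and stationary actions\<close>

text \<open>Stationarity is kept out of the locale and becomes a predicate on an arbitrary pmf,
  because it is used for all convolution powers.\<close>

locale nonsingular_action = prob_space M
  for M :: "'x measure" and act :: "'g::{group_add, countable} \<Rightarrow> 'x \<Rightarrow> 'x" +
  assumes act_0: "act 0 x = x"
    and act_add: "act (s + t) x = act s (act t x)"
    and measurable_act [measurable]: "act s \<in> M \<rightarrow>\<^sub>M M"
    and null_act: "A \<in> sets M \<Longrightarrow> emeasure M A = 0 \<Longrightarrow> emeasure M (act s -` A \<inter> space M) = 0"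
begin

section \<open>Basic laws of the action and the Radon-Nikodym cocycle\<close>

lemma act_minus: "act (- s) (act s x) = x" "act s (act (- s) x) = x"
  using act_add[of "- s" s x] act_add[of s "- s" x] by (simp_all add: act_0)

lemma absolutely_continuous_distr_act: "absolutely_continuous M (distr M M (act s))"
  by (auto simp: absolutely_continuous_def null_sets_def emeasure_distr null_act)

lemma AE_act:
  assumes "AE x in M. P x"
  shows "AE x in M. P (act s x)"
proof -
  have "AE x in distr M M (act s). P x"
    using assms by (rule absolutely_continuous_AE[rotated 2])
      (simp_all add: absolutely_continuous_distr_act)
  then show ?thesis by (rule AE_distrD[rotated]) simp
qed

lemma rho_nonneg [simp]: "0 \<le> rho M act s x"
  by (simp add: rho_def)

lemma borel_measurable_rho [measurable]: "rho M act s \<in> borel_measurable M"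
  unfolding rho_def by measurable

text \<open>\<open>rho\<close> is made real by \<open>enn2real\<close>, which sends infinite values
  to 0. The image measure is finite, so its derivative is finite almost everywhere and nothing is
  lost.\<close>

lemma AE_RN_deriv_eq_rho:
  "AE x in M. RN_deriv M (distr M M (act (- s))) x = ennreal (rho M act s x)"
proof -
  interpret D: prob_space "distr M M (act (- s))" by (rule prob_space_distr) simp
  have "AE x in M. RN_deriv M (distr M M (act (- s))) x \<noteq> \<infinity>"
    by (intro RN_deriv_finite absolutely_continuous_distr_act) (auto intro: D.sigma_finite_measure_axioms)
  then show ?thesis by eventually_elim (simp add: rho_def less_top)
qed

text \<open>Together with the uniqueness statement \<open>AE_eq_rhoI\<close>, this change of
  variables replaces direct work with \<open>RN_deriv\<close> in what follows.\<close>

lemma nn_integral_act_minus: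
  assumes [measurable]: "F \<in> borel_measurable M"
  shows "(\<integral>\<^sup>+x. F (act (- s) x) \<partial>M) = (\<integral>\<^sup>+x. ennreal (rho M act s x) * F x \<partial>M)"
proof -
  have "(\<integral>\<^sup>+x. F (act (- s) x) \<partial>M) = (\<integral>\<^sup>+x. F x \<partial>distr M M (act (- s)))"
    by (simp add: nn_integral_distr)
  also have "\<dots> = (\<integral>\<^sup>+x. RN_deriv M (distr M M (act (- s))) x * F x \<partial>M)"
    by (intro RN_deriv_nn_integral absolutely_continuous_distr_act) auto
  also have "\<dots> = (\<integral>\<^sup>+x. ennreal (rho M act s x) * F x \<partial>M)"
    using AE_RN_deriv_eq_rho[of s] by (intro nn_integral_cong_AE) auto
  finally show ?thesis .
qed

lemma nn_integral_rho: "(\<integral>\<^sup>+x. ennreal (rho M act s x) \<partial>M) = 1"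
  using nn_integral_act_minus[of "\<lambda>_. 1" s] by (simp add: emeasure_space_1)

lemma integrable_rho [simp]: "integrable M (rho M act s)"
  by (simp add: integrable_iff_bounded nn_integral_rho)

lemma integrable_sqrt_rho: "integrable M (\<lambda>x. sqrt (rho M act s x))"
proof (rule Bochner_Integration.integrable_bound)
  show "AE x in M. norm (sqrt (rho M act s x)) \<le> norm ((1 + rho M act s x) / 2)"
  proof (rule AE_I2)
    fix x
    have "sqrt (rho M act s x) \<le> (1 + rho M act s x) / 2"
      using arith_geo_mean_sqrt[of 1 "rho M act s x"] by simp
    then show "norm (sqrt (rho M act s x)) \<le> norm ((1 + rho M act s x) / 2)"
      by (metis abs_ge_self abs_of_nonneg order_trans real_norm_def real_sqrt_ge_zero rho_nonneg)
  qed
qed simp_all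

lemma integral_rho [simp]: "(\<integral>x. rho M act s x \<partial>M) = 1"
  by (simp add: integral_eq_nn_integral nn_integral_rho)

lemma AE_eq_rhoI:
  assumes [measurable]: "r \<in> borel_measurable M"
    and nn: "\<And>x. 0 \<le> r x"
    and eq: "\<And>A. A \<in> sets M \<Longrightarrow>
      (\<integral>\<^sup>+x. ennreal (r x) * indicator A x \<partial>M) = (\<integral>\<^sup>+x. indicator A (act (- s) x) \<partial>M)"
  shows "AE x in M. rho M act s x = r x"
proof -
  have "density M (\<lambda>x. ennreal (r x)) = distr M M (act (- s))"
  proof (rule measure_eqI)
    fix A assume "A \<in> sets (density M (\<lambda>x. ennreal (r x)))"
    then have A [measurable]: "A \<in> sets M" by simp
    have "(\<integral>\<^sup>+x. indicator A (act (- s) x) \<partial>M) = emeasure (distr M M (act (- s))) A"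
      using nn_integral_distr[of "act (- s)" M M "indicator A"] by simp
    then show "emeasure (density M (\<lambda>x. ennreal (r x))) A = emeasure (distr M M (act (- s))) A"
      using eq[OF A] by (simp add: emeasure_density)
  qed simp
  then have "AE x in M. ennreal (r x) = RN_deriv M (distr M M (act (- s))) x"
    by (rule RN_deriv_unique[rotated]) simp
  then show ?thesis
    by eventually_elim (metis enn2real_ennreal nn rho_def)
qed

text \<open>Both sides are densities of the image of \<open>M\<close> under
  \<open>act (- (t + u))\<close>, which applies \<open>act (- t)\<close> first and
  \<open>act (- u)\<close> second. The change of variables for \<open>u\<close> absorbs the factor
  \<open>rho M act u x\<close>, and the one for \<open>t\<close> absorbs what remains.\<close>

lemma rho_cocycle: "AE x in M. rho M act (t + u) x = rho M act u x * rho M act t (act u x)"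
proof (rule AE_eq_rhoI)
  fix A assume [measurable]: "A \<in> sets M"
  have "(\<integral>\<^sup>+x. ennreal (rho M act u x * rho M act t (act u x)) * indicator A x \<partial>M)
      = (\<integral>\<^sup>+x. ennreal (rho M act u x) * (ennreal (rho M act t (act u x)) * indicator A x) \<partial>M)"
    by (simp add: ennreal_mult mult_ac)
  also have "\<dots> = (\<integral>\<^sup>+x. ennreal (rho M act t x) * indicator A (act (- u) x) \<partial>M)"
    by (subst nn_integral_act_minus[symmetric]) (simp_all add: act_minus)
  also have "\<dots> = (\<integral>\<^sup>+x. indicator A (act (- u) (act (- t) x)) \<partial>M)"
    by (subst nn_integral_act_minus[symmetric]) simp_all
  finally show "(\<integral>\<^sup>+x. ennreal (rho M act u x * rho M act t (act u x)) * indicator A x \<partial>M)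
      = (\<integral>\<^sup>+x. indicator A (act (- (t + u)) x) \<partial>M)"
    by (simp only: minus_add act_add)
qed simp_all

lemma rho_0: "AE x in M. rho M act 0 x = 1"
  by (rule AE_eq_rhoI) (simp_all add: act_0)

text \<open>The cocycle identity for \<open>- s + s = 0\<close> exhibits 1 as a multiple of
  \<open>rho M act s x\<close>.\<close>

lemma rho_pos: "AE x in M. 0 < rho M act s x"
  using rho_cocycle[of "- s" s] rho_0
proof eventually_elim
  case (elim x)
  then have "rho M act s x \<noteq> 0" by auto
  then show ?case using rho_nonneg[of s x] by linarith
qed

section \<open>Stationarity and its passage to convolution powers\<close>

definition stationary :: "'g pmf \<Rightarrow> bool" where
  "stationary q \<longleftrightarrow>
    (\<forall>A\<in>sets M. (\<integral>\<^sup>+s. emeasure M (act s -` A \<inter> space M) \<partial>q) = emeasure M A)"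

lemma stationary_return: "stationary (return_pmf 0)"
proof -
  have "act 0 -` A \<inter> space M = A" if "A \<in> sets M" for A
    using sets.sets_into_space[OF that] by (auto simp: act_0)
  then show ?thesis by (simp add: stationary_def)
qed

text \<open>The preimage under \<open>act (t + u)\<close> is the preimage under \<open>act u\<close>
  of the preimage under \<open>act t\<close>. Integrating over \<open>u\<close> removes
  \<open>act u\<close> by stationarity for \<open>q\<close>; integrating over \<open>t\<close> then
  removes \<open>act t\<close> by stationarity for \<open>p\<close>.\<close>

lemma stationary_convol:
  assumes "stationary p" "stationary q"
  shows "stationary (convol_pmf p q)"
  unfolding stationary_def
proof
  fix A assume A: "A \<in> sets M"
  have eq: "act (t + u) -` A \<inter> space M = act u -` (act t -` A \<inter> space M) \<inter> space M" for t u
    using measurable_space[OF measurable_act] by (auto simp: act_add)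
  have "(\<integral>\<^sup>+u. emeasure M (act (t + u) -` A \<inter> space M) \<partial>q) = emeasure M (act t -` A \<inter> space M)" for t
    using assms(2) measurable_sets[OF measurable_act A] unfolding stationary_def eq by blast
  then show "(\<integral>\<^sup>+s. emeasure M (act s -` A \<inter> space M) \<partial>convol_pmf p q) = emeasure M A"
    using assms(1) A by (simp add: nn_integral_convol_pmf stationary_def)
qed

lemma stationary_convol_pow: "stationary p \<Longrightarrow> stationary (convol_pow_pmf p n)"
  by (induction n) (simp_all add: stationary_return stationary_convol)

text \<open>Joint measurability reduces to that of each \<open>act s\<close> because the group is
  countable.\<close>

lemma measurable_act_pair [measurable]:
  "(\<lambda>(s, x). act s x) \<in> measure_pmf q \<Otimes>\<^sub>M M \<rightarrow>\<^sub>M M"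
proof -
  have "(\<lambda>(s, x). act s x) \<in> count_space UNIV \<Otimes>\<^sub>M M \<rightarrow>\<^sub>M M"
    by (rule measurable_pair_measure_countable1) auto
  moreover have "sets (measure_pmf q \<Otimes>\<^sub>M M) = sets (count_space UNIV \<Otimes>\<^sub>M M)"
    by (intro sets_pair_measure_cong) simp_all
  ultimately show ?thesis by (subst measurable_cong_sets[OF _ refl])
qed

text \<open>In this form stationarity extends from sets to integrable functions, by a change of
  variables and Fubini's theorem.\<close>

lemma distr_act_pair:
  assumes "stationary q"
  shows "distr (measure_pmf q \<Otimes>\<^sub>M M) M (\<lambda>(s, x). act s x) = M"
proof (rule measure_eqI)
  fix A assume "A \<in> sets (distr (measure_pmf q \<Otimes>\<^sub>M M) M (\<lambda>(s, x). act s x))"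
  then have A [measurable]: "A \<in> sets M" by simp
  have "emeasure (distr (measure_pmf q \<Otimes>\<^sub>M M) M (\<lambda>(s, x). act s x)) A
      = emeasure (measure_pmf q \<Otimes>\<^sub>M M)
          ((\<lambda>(s, x). act s x) -` A \<inter> space (measure_pmf q \<Otimes>\<^sub>M M))"
    by (rule emeasure_distr) simp_all
  also have "\<dots> = (\<integral>\<^sup>+s. emeasure M
      (Pair s -` ((\<lambda>(s, x). act s x) -` A \<inter> space (measure_pmf q \<Otimes>\<^sub>M M))) \<partial>q)"
    by (rule emeasure_pair_measure_alt) simp
  also have "\<dots> = (\<integral>\<^sup>+s. emeasure M (act s -` A \<inter> space M) \<partial>q)"
    by (intro nn_integral_cong arg_cong[where f="emeasure M"]) (auto simp: space_pair_measure)
  also have "\<dots> = emeasure M A" using assms A by (simp add: stationary_def)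
  finally show "emeasure (distr (measure_pmf q \<Otimes>\<^sub>M M) M (\<lambda>(s, x). act s x)) A = emeasure M A" .
qed simp

lemma stationary_integral:
  fixes F :: "'x \<Rightarrow> real"
  assumes "stationary q" and F: "integrable M F"
  shows "integrable (measure_pmf q) (\<lambda>s. \<integral>x. F (act s x) \<partial>M)"
    and "(\<integral>s. (\<integral>x. F (act s x) \<partial>M) \<partial>q) = (\<integral>x. F x \<partial>M)"
proof -
  interpret P: pair_sigma_finite "measure_pmf q" M ..
  have [measurable]: "F \<in> borel_measurable M" using F by simp
  have i: "integrable (measure_pmf q \<Otimes>\<^sub>M M) (\<lambda>z. F (case z of (s, x) \<Rightarrow> act s x))"
    by (rule integrable_distr[OF measurable_act_pair]) (simp only: distr_act_pair[OF assms(1)] F)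
  have "(\<integral>s. (\<integral>x. F (act s x) \<partial>M) \<partial>q)
      = (\<integral>z. F (case z of (s, x) \<Rightarrow> act s x) \<partial>(measure_pmf q \<Otimes>\<^sub>M M))"
    using P.integral_fst'[OF i] by simp
  also have "\<dots> = (\<integral>x. F x \<partial>distr (measure_pmf q \<Otimes>\<^sub>M M) M (\<lambda>(s, x). act s x))"
    by (rule integral_distr[symmetric]) simp_all
  finally show "(\<integral>s. (\<integral>x. F (act s x) \<partial>M) \<partial>q) = (\<integral>x. F x \<partial>M)"
    by (simp only: distr_act_pair[OF assms(1)])
  show "integrable (measure_pmf q) (\<lambda>s. \<integral>x. F (act s x) \<partial>M)"
    using P.integrable_fst'[OF i] by simp
qed

text \<open>Keeping only the term \<open>t = s\<close> in the stationarity equation for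
  \<open>?B\<close>, the translate of the bad set \<open>?A\<close>, bounds
  \<open>pmf q s * measure M ?A\<close> by the integral of \<open>rho M act s\<close> over
  \<open>?A\<close>. On \<open>?A\<close> this density lies strictly below \<open>pmf q s\<close>,
  so \<open>?A\<close> must be null.\<close>

lemma rho_ge_stationary:
  assumes "stationary q"
  shows "AE x in M. pmf q s \<le> rho M act s x"
proof -
  let ?A = "{x \<in> space M. rho M act s x < pmf q s}"
  let ?B = "act (- s) -` ?A \<inter> space M"
  have A [measurable]: "?A \<in> sets M" by measurable
  have B [measurable]: "?B \<in> sets M" by measurable
  have eq: "act s -` ?B \<inter> space M = ?A"
    using measurable_space[OF measurable_act] by (auto simp: act_minus)
  have "ennreal (pmf q s) * emeasure M ?A = (\<integral>\<^sup>+t. emeasure M ?A * indicator {s} t \<partial>q)"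
    by (subst nn_integral_cmult) (simp_all add: emeasure_pmf_single mult.commute)
  also have "\<dots> \<le> (\<integral>\<^sup>+t. emeasure M (act t -` ?B \<inter> space M) \<partial>q)"
    using eq by (intro nn_integral_mono) (simp add: indicator_def)
  also have "\<dots> = emeasure M ?B" using assms B by (simp only: stationary_def)
  also have "\<dots> = (\<integral>\<^sup>+x. indicator ?B x \<partial>M)"
    by (rule nn_integral_indicator[OF B, symmetric])
  also have "\<dots> = (\<integral>\<^sup>+x. indicator ?A (act (- s) x) \<partial>M)"
    by (intro nn_integral_cong) (simp add: indicator_def)
  also have "\<dots> = (\<integral>\<^sup>+x. ennreal (rho M act s x) * indicator ?A x \<partial>M)"
    by (rule nn_integral_act_minus) simp
  also have "\<dots> = (\<integral>\<^sup>+x. ennreal (rho M act s x * indicator ?A x) \<partial>M)"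
    by (intro nn_integral_cong) (simp split: split_indicator)
  also have "\<dots> = ennreal (\<integral>x. rho M act s x * indicator ?A x \<partial>M)"
    by (intro nn_integral_eq_integral integrable_real_mult_indicator A) auto
  finally have le: "pmf q s * measure M ?A \<le> (\<integral>x. rho M act s x * indicator ?A x \<partial>M)"
    by (simp add: emeasure_eq_measure ennreal_mult[symmetric] integral_nonneg_AE)
  have i1: "integrable M (\<lambda>x. pmf q s * indicator ?A x)"
    and i2: "integrable M (\<lambda>x. rho M act s x * indicator ?A x)"
    by (intro integrable_real_mult_indicator A; simp)+
  have i: "integrable M (\<lambda>x. (pmf q s - rho M act s x) * indicator ?A x)"
    by (intro integrable_real_mult_indicator) auto
  have "(\<integral>x. (pmf q s - rho M act s x) * indicator ?A x \<partial>M)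
      = pmf q s * measure M ?A - (\<integral>x. rho M act s x * indicator ?A x \<partial>M)"
    unfolding left_diff_distrib using Bochner_Integration.integral_diff[OF i1 i2] by simp
  then have "(\<integral>x. (pmf q s - rho M act s x) * indicator ?A x \<partial>M) = 0"
    using le Bochner_Integration.integral_nonneg[of M "\<lambda>x. (pmf q s - rho M act s x) * indicator ?A x"]
    by (simp add: indicator_def)
  then have "AE x in M. (pmf q s - rho M act s x) * indicator ?A x = 0"
    by (subst (asm) integral_nonneg_eq_0_iff_AE[OF i]) (auto simp: indicator_def)
  then show ?thesis
    by (rule AE_mp[OF _ AE_I2]) (auto simp: indicator_def split: if_splits)
qed

section \<open>The relative entropy of \<open>M\<close> with respect to its image under
  \<open>act (- s)\<close>\<close>

definition info :: "'g \<Rightarrow> real" where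
  "info s = - (\<integral>x. ln (rho M act s x) \<partial>M)"

text \<open>A stationary \<open>q\<close> that charges \<open>s\<close> bounds
  \<open>rho M act s\<close> away from 0 almost everywhere, which is what makes its logarithm
  integrable.\<close>

context
  fixes q s
  assumes stat: "stationary q" and supp: "s \<in> set_pmf q"
begin

lemma integrable_ln_rho: "integrable M (\<lambda>x. ln (rho M act s x))"
proof (rule Bochner_Integration.integrable_bound)
  \<comment> \<open>The dominating function adds up the two one-sided bounds:
    \<open>- ln (pmf q s)\<close> controls the negative part of the logarithm and
    \<open>rho M act s x\<close> the positive part.\<close>
  show "integrable M (\<lambda>x. rho M act s x - ln (pmf q s))" by simp
  show "AE x in M. norm (ln (rho M act s x)) \<le> norm (rho M act s x - ln (pmf q s))"
    using rho_ge_stationary[OF stat, of s]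
  proof eventually_elim
    case (elim x)
    have "ln (pmf q s) \<le> ln (rho M act s x)"
      using elim pmf_positive[OF supp] by simp
    moreover have "ln (rho M act s x) \<le> rho M act s x - 1"
      using elim pmf_positive[OF supp] by (intro ln_le_minus_one) auto
    ultimately show ?case
      using ln_pmf_nonpos[of q s] rho_nonneg[of s x] unfolding real_norm_def by linarith
  qed
qed simp

lemma info_nonneg: "0 \<le> info s"
proof -
  have "(\<integral>x. ln (rho M act s x) \<partial>M) \<le> (\<integral>x. rho M act s x - 1 \<partial>M)"
    using rho_pos[of s] integrable_ln_rho
    by (intro integral_mono_AE) (auto elim!: eventually_mono intro: ln_le_minus_one)
  then show ?thesis by (simp add: info_def prob_space)
qed

lemma info_le: "info s \<le> - ln (pmf q s)"
proof -
  have "(\<integral>x. ln (pmf q s) \<partial>M) \<le> (\<integral>x. ln (rho M act s x) \<partial>M)"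
    using rho_ge_stationary[OF stat, of s] integrable_ln_rho pmf_positive[OF supp]
    by (intro integral_mono_AE) (auto elim!: eventually_mono)
  then show ?thesis by (simp add: info_def prob_space)
qed

text \<open>The middle bound is Jensen's inequality in tangent form: \<open>ln y \<le> y - 1\<close>
  is integrated at \<open>y = sqrt (rho M act s x) / Xi M act s\<close>, which has mean 1.
  Positivity comes from \<open>rho_pos\<close>, and the upper bound 1 from the arithmetic-geometric
  mean inequality.\<close>

lemma Xi_bounds: "0 < Xi M act s" "- 2 * ln (Xi M act s) \<le> info s" "Xi M act s \<le> 1"
proof -
  note i = integrable_sqrt_rho[of s]
  have "(\<integral>x. sqrt (rho M act s x) \<partial>M) \<noteq> 0"
  proof
    assume "(\<integral>x. sqrt (rho M act s x) \<partial>M) = 0"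
    then have "AE x in M. sqrt (rho M act s x) = 0"
      by (subst (asm) integral_nonneg_eq_0_iff_AE[OF i]) auto
    with rho_pos[of s] have "AE x in M. False" by eventually_elim auto
    then show False by simp
  qed
  moreover have "0 \<le> (\<integral>x. sqrt (rho M act s x) \<partial>M)" by simp
  ultimately show pos: "0 < Xi M act s" unfolding Xi_def by linarith
  have "Xi M act s \<le> (\<integral>x. (1 + rho M act s x) / 2 \<partial>M)"
    unfolding Xi_def
  proof (intro integral_mono)
    fix x show "sqrt (rho M act s x) \<le> (1 + rho M act s x) / 2"
      using arith_geo_mean_sqrt[of 1 "rho M act s x"] by simp
  qed (use i in simp_all)
  then show "Xi M act s \<le> 1" by (simp add: prob_space)
  have "(\<integral>x. ln (rho M act s x) / 2 \<partial>M)
      \<le> (\<integral>x. sqrt (rho M act s x) / Xi M act s - 1 + ln (Xi M act s) \<partial>M)"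
  proof (intro integral_mono_AE)
    show "AE x in M. ln (rho M act s x) / 2
        \<le> sqrt (rho M act s x) / Xi M act s - 1 + ln (Xi M act s)"
      using rho_pos[of s]
    proof eventually_elim
      case (elim x)
      then have "ln (sqrt (rho M act s x) / Xi M act s) \<le> sqrt (rho M act s x) / Xi M act s - 1"
        using pos by (intro ln_le_minus_one) auto
      moreover have "ln (sqrt (rho M act s x) / Xi M act s) = ln (rho M act s x) / 2 - ln (Xi M act s)"
        using elim pos by (simp add: ln_div ln_sqrt)
      ultimately show ?case by linarith
    qed
  qed (use i integrable_ln_rho in simp_all)
  also have "\<dots> = ln (Xi M act s)"
    using i pos by (simp add: prob_space Xi_def[symmetric])
  finally show "- 2 * ln (Xi M act s) \<le> info s" by (simp add: info_def)
qed

end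

lemma integrable_info:
  assumes "stationary q" "nn_entropy q < \<infinity>"
  shows "integrable (measure_pmf q) info"
proof (rule Bochner_Integration.integrable_bound)
  show "integrable (measure_pmf q) (\<lambda>s. - ln (pmf q s))"
    using assms(2) by (simp only: integrable_ln_pmf_iff)
  show "AE s in measure_pmf q. norm (info s) \<le> norm (- ln (pmf q s))"
  proof (rule AE_pmfI)
    fix s assume "s \<in> set_pmf q"
    from info_nonneg[OF assms(1) this] info_le[OF assms(1) this]
    show "norm (info s) \<le> norm (- ln (pmf q s))" by simp
  qed
qed simp

text \<open>The test function is chosen so that its weighted norm squared and the pairing of its
  Koopman image of 1 with 1 are the same finite sum \<open>S\<close>. Then \<open>S\<close> is at
  most the norm of that image, hence at most \<open>C * sqrt S\<close>, which gives a bound on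
  \<open>S\<close> independent of the finite set.\<close>

lemma rapid_decay_bound:
  assumes L: "is_length_function L" and RD: "has_RD L"
    and weak: "weakly_contained_in_regular M act"
  shows "\<exists>d K. 0 < K \<and> (\<forall>F. finite F \<longrightarrow> (\<Sum>s\<in>F. (Xi M act s)\<^sup>2 / (1 + L s) ^ (2 * d)) \<le> K)"
proof -
  obtain d :: nat and C :: real where dC: "\<And>f phi. fin_supp f \<Longrightarrow> is_l2 phi \<Longrightarrow>
      l2norm (lam f phi) \<le> C * l2norm (\<lambda>s. f s * complex_of_real ((1 + L s) ^ d)) * l2norm phi"
    using RD unfolding has_RD_def by blast
  define w where "w s = (1 + L s) ^ d" for s
  have w_pos: "0 < w s" for s
    using length_function_nonneg[OF L, of s] by (simp add: w_def)
  have w_minus: "w (- s) = w s" for s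
    using L by (simp add: w_def is_length_function_def)
  \<comment> \<open>The summand 1 keeps the bound positive, so that its logarithm can be used in the
    Gibbs inequality.\<close>
  have "(\<Sum>s\<in>F. (Xi M act s)\<^sup>2 / (1 + L s) ^ (2 * d)) \<le> C\<^sup>2 + 1" if F: "finite F" for F
  proof -
    \<comment> \<open>The Koopman operator of $s$ carries the density \<open>rho M act (- s)\<close>, so the test function lives on $F^{-1}$.\<close>
    define G where "G = uminus ` F"
    have G: "finite G" using F by (simp add: G_def)
    define c where "c s = Xi M act (- s) / (w s)\<^sup>2" for s
    define f where "f s = complex_of_real (if s \<in> G then c s else 0)" for s
    define k where "k x = (\<Sum>s\<in>G. c s * sqrt (rho M act (- s) x))" for x
    define S where "S = (\<Sum>s\<in>G. (Xi M act (- s) / w s)\<^sup>2)"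
    have S_nn: "0 \<le> S" by (simp add: S_def sum_nonneg)
    have sub: "{s. f s \<noteq> 0} \<subseteq> G" by (auto simp: f_def)
    then have fin: "fin_supp f" using G by (auto simp: fin_supp_def intro: finite_subset)
    have fw: "f s * complex_of_real (w s) = complex_of_real (if s \<in> G then Xi M act (- s) / w s else 0)" for s
      using w_pos[of s] unfolding f_def of_real_mult[symmetric] of_real_eq_iff
      by (simp add: c_def power2_eq_square)
    have "(\<Sum>\<^sub>\<infinity>s. (cmod (f s * complex_of_real (w s)))\<^sup>2) = (\<Sum>\<^sub>\<infinity>s\<in>G. (Xi M act (- s) / w s)\<^sup>2)"
      unfolding fw norm_of_real power2_abs by (intro infsum_cong_neutral) auto
    then have "l2norm (\<lambda>s. f s * complex_of_real ((1 + L s) ^ d)) = sqrt S"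
      using G by (simp add: l2norm_def w_def[symmetric] S_def)
    \<comment> \<open>Property RD makes \<open>C * sqrt S\<close> a bound for the convolution
      operator of \<open>f\<close>; weak containment transfers it to the Koopman operator.\<close>
    then have "\<And>g. is_L2 M g \<Longrightarrow> L2norm M (koopman_alg M act f g) \<le> C * sqrt S * L2norm M g"
      using dC[OF fin] weak fin unfolding weakly_contained_in_regular_def by simp
    from this[of "\<lambda>_. 1"] have "L2norm M (koopman_alg M act f (\<lambda>_. 1)) \<le> C * sqrt S"
      by (simp add: is_L2_def L2norm_def prob_space)
    moreover have "koopman_alg M act f (\<lambda>_. 1) x = complex_of_real (k x)" for x
      unfolding koopman_alg_def k_def koopman_def rho_def of_real_sum
      using sub G by (intro sum.mono_neutral_cong_left) (auto simp: f_def)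
    ultimately have le: "sqrt (\<integral>x. (k x)\<^sup>2 \<partial>M) \<le> C * sqrt S"
      by (simp add: L2norm_def)
    have ik: "integrable M k"
      unfolding k_def using integrable_sqrt_rho by simp
    have ik2: "integrable M (\<lambda>x. (k x)\<^sup>2)"
    proof (rule Bochner_Integration.integrable_bound)
      show "integrable M (\<lambda>x. (\<Sum>s\<in>G. (c s)\<^sup>2) * (\<Sum>s\<in>G. rho M act (- s) x))" by simp
      have "(k x)\<^sup>2 \<le> (\<Sum>s\<in>G. (c s)\<^sup>2) * (\<Sum>s\<in>G. rho M act (- s) x)" for x
        using Cauchy_Schwarz_ineq_sum[of c "\<lambda>s. sqrt (rho M act (- s) x)" G] by (simp add: k_def)
      then show "AE x in M. norm ((k x)\<^sup>2) \<le> norm ((\<Sum>s\<in>G. (c s)\<^sup>2) * (\<Sum>s\<in>G. rho M act (- s) x))"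
        by (intro AE_I2) (metis abs_ge_self abs_of_nonneg order_trans real_norm_def zero_le_power2)
    qed (simp add: k_def)
    have "(\<integral>x. k x \<partial>M) = (\<Sum>s\<in>G. c s * Xi M act (- s))"
      unfolding k_def Xi_def using integrable_sqrt_rho by simp
    also have "\<dots> = S"
      unfolding S_def c_def by (intro sum.cong) (simp_all add: power2_eq_square)
    \<comment> \<open>The variance of \<open>k\<close> is nonnegative, so the square of its mean
      \<open>S\<close> is at most its second moment.\<close>
    finally have "S\<^sup>2 \<le> (\<integral>x. (k x)\<^sup>2 \<partial>M)"
      using variance_eq[OF ik ik2] variance_positive[of k] by simp
    then have "S \<le> C * sqrt S"
      using le real_le_rsqrt order_trans by blast
    then have "sqrt S * sqrt S \<le> C * sqrt S" using S_nn by simp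
    \<comment> \<open>Nothing is known about the sign of \<open>C\<close>, hence the absolute value;
      the case \<open>S = 0\<close> is separate because \<open>sqrt S\<close> is cancelled.\<close>
    then have "sqrt S \<le> \<bar>C\<bar>"
      using S_nn mult_right_le_imp_le[of "sqrt S" "sqrt S" C] by (cases "S = 0") force+
    then have "S \<le> C\<^sup>2"
      by (metis S_nn abs_ge_zero power2_abs power_mono real_sqrt_ge_zero real_sqrt_pow2)
    moreover have "S = (\<Sum>s\<in>F. (Xi M act s / w s)\<^sup>2)"
      unfolding S_def G_def by (subst sum.reindex) (simp_all add: w_minus)
    then have "S = (\<Sum>s\<in>F. (Xi M act s)\<^sup>2 / (1 + L s) ^ (2 * d))"
      by (simp add: power_divide w_def power_mult[symmetric] mult.commute)
    ultimately show ?thesis by simp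
  qed
  moreover have "0 < C\<^sup>2 + 1" by (simp add: add_nonneg_pos)
  ultimately show ?thesis by blast
qed

section \<open>Additivity of the mean information along convolution powers\<close>

lemma info_add:
  assumes "stationary p" "stationary q" "t \<in> set_pmf p" "u \<in> set_pmf q"
  shows "info (t + u) = info u - (\<integral>x. ln (rho M act t (act u x)) \<partial>M)"
proof -
  have ae: "AE x in M. ln (rho M act t (act u x)) = ln (rho M act (t + u) x) - ln (rho M act u x)"
    using rho_cocycle[of t u] rho_pos[of u] AE_act[OF rho_pos[of t], of u]
    by eventually_elim (simp add: ln_mult)
  have i: "integrable M (\<lambda>x. ln (rho M act (t + u) x))" "integrable M (\<lambda>x. ln (rho M act u x))"
    using integrable_ln_rho[OF stationary_convol[OF assms(1,2)] set_convol_pmf[OF assms(3,4)]]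
      integrable_ln_rho[OF assms(2,4)] by auto
  have "(\<integral>x. ln (rho M act t (act u x)) \<partial>M)
      = (\<integral>x. ln (rho M act (t + u) x) - ln (rho M act u x) \<partial>M)"
    using ae by (intro integral_cong_AE) auto
  also have "\<dots> = - info (t + u) + info u" using i by (simp add: info_def)
  finally show ?thesis by simp
qed

text \<open>The correction term in \<open>info_add\<close> depends on \<open>u\<close> only through
  a translation of \<open>M\<close>, so stationarity of \<open>q\<close> averages it to
  \<open>- info t\<close>. The nonnegative integral is the form that
  \<open>nn_integral_convol_pmf\<close> produces.\<close>

lemma nn_integral_info_translate:
  assumes "stationary p" "stationary q" "t \<in> set_pmf p" "nn_entropy q < \<infinity>"
  shows "(\<integral>\<^sup>+u. ennreal (info (t + u)) \<partial>q) = ennreal (measure_pmf.expectation q info + info t)"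
proof -
  let ?J = "\<lambda>u. info u - (\<integral>x. ln (rho M act t (act u x)) \<partial>M)"
  note st = stationary_integral[OF assms(2) integrable_ln_rho[OF assms(1,3)]]
  have "(\<integral>\<^sup>+u. ennreal (info (t + u)) \<partial>q) = (\<integral>\<^sup>+u. ennreal (?J u) \<partial>q)"
    by (intro nn_integral_cong_AE AE_pmfI) (simp add: info_add[OF assms(1-3)])
  also have "\<dots> = ennreal (\<integral>u. ?J u \<partial>q)"
  proof (intro nn_integral_eq_integral AE_pmfI)
    fix u assume "u \<in> set_pmf q"
    then show "0 \<le> ?J u"
      using info_nonneg[OF stationary_convol[OF assms(1,2)] set_convol_pmf[OF assms(3)]]
      by (simp add: info_add[OF assms(1-3)])
  qed (use st integrable_info[OF assms(2,4)] in simp)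
  also have "(\<integral>u. ?J u \<partial>q) = measure_pmf.expectation q info + info t"
    using st integrable_info[OF assms(2,4)] by (simp add: info_def[of t])
  finally show ?thesis .
qed

text \<open>Since \<open>info\<close> is nonnegative on the supports involved, each expectation can
  be computed as an iterated nonnegative integral, and one convolution step adds exactly one copy of
  the mean under \<open>p\<close>.\<close>

lemma expectation_info_convol_pow:
  assumes p: "stationary p" "nn_entropy p < \<infinity>"
  shows "measure_pmf.expectation (convol_pow_pmf p n) info = real n * measure_pmf.expectation p info"
proof (induction n)
  case 0
  have "info 0 = 0"
    unfolding info_def using rho_0 by (subst integral_cong_AE[where g="\<lambda>_. 0"]) auto
  then show ?case by simp
next
  case (Suc n)
  let ?q = "convol_pow_pmf p n" and ?r = "convol_pow_pmf p (Suc n)"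
  note q = stationary_convol_pow[OF p(1), of n] nn_entropy_convol_pow_pmf[OF p(2), of n]
  note r = stationary_convol_pow[OF p(1), of "Suc n"] nn_entropy_convol_pow_pmf[OF p(2), of "Suc n"]
  have nn: "0 \<le> measure_pmf.expectation q info" if "stationary q" for q
    using info_nonneg[OF that] by (intro integral_nonneg_AE AE_pmfI)
  have "ennreal (measure_pmf.expectation ?r info) = (\<integral>\<^sup>+s. ennreal (info s) \<partial>?r)"
    using integrable_info[OF r] info_nonneg[OF r(1)]
    by (intro nn_integral_eq_integral[symmetric] AE_pmfI)
  also have "\<dots> = (\<integral>\<^sup>+t. \<integral>\<^sup>+u. ennreal (info (t + u)) \<partial>?q \<partial>p)"
    by (simp add: nn_integral_convol_pmf)
  also have "\<dots> = (\<integral>\<^sup>+t. ennreal (measure_pmf.expectation ?q info + info t) \<partial>p)"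
    by (intro nn_integral_cong_AE AE_pmfI nn_integral_info_translate[OF p(1) q(1) _ q(2)])
  also have "\<dots> = ennreal (\<integral>t. measure_pmf.expectation ?q info + info t \<partial>p)"
    using integrable_info[OF p] info_nonneg[OF p(1)] nn[OF q(1)]
    by (intro nn_integral_eq_integral AE_pmfI) auto
  also have "(\<integral>t. measure_pmf.expectation ?q info + info t \<partial>p) = real (Suc n) * measure_pmf.expectation p info"
    using integrable_info[OF p] Suc by (simp add: algebra_simps)
  finally show ?case
    using nn[OF r(1)] nn[OF p(1)] by (simp del: convol_pow_pmf.simps)
qed

end

subsection \<open>The entropy formula\<close>

theorem theorem6p2:
  fixes mu :: "'g::{group_add, countable} \<Rightarrow> real"
    and L :: "'g \<Rightarrow> real"
    and M :: "'x::polish_space measure"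
    and act :: "'g \<Rightarrow> 'x \<Rightarrow> 'x"
  assumes "is_length_function L"
    and "has_RD L"
    and "is_prob_measure mu"
    and "non_degenerate mu"
    and "(\<lambda>s. ent_term (mu s)) summable_on UNIV"
    and "(\<lambda>s. mu s * ln (1 + L s)) summable_on UNIV"
    and "stationary_space mu M act"
    and "weakly_contained_in_regular M act"
  shows "furstenberg_entropy mu M act = avez_entropy mu \<and>
           (\<lambda>n. shannon_entropy (conv_pow mu n) / real n) \<longlonglongrightarrow> avez_entropy mu \<and>
           (\<lambda>n. -2 * (\<Sum>\<^sub>\<infinity>s. conv_pow mu n s * ln (Xi M act s)) / real n)
           \<longlonglongrightarrow> avez_entropy mu"
proof -
  define p where "p = embed_pmf mu"
  have pmf_p: "pmf p = mu"
    unfolding p_def using assms(3) by (rule pmf_embed_is_prob_measure)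
  interpret prob_space M using assms(7) by (simp add: stationary_space_def)
  interpret nonsingular_action M act
    using assms(7) by unfold_locales (auto simp: stationary_space_def)
  have stat: "stationary p"
    unfolding stationary_def
  proof
    fix A assume "A \<in> sets M"
    then have hs: "((\<lambda>s. pmf p s * measure M (act s -` A \<inter> space M)) has_sum measure M A) UNIV"
      using assms(7) by (simp add: stationary_space_def pmf_p)
    have int: "integrable (measure_pmf p) (\<lambda>s. measure M (act s -` A \<inter> space M))"
      using has_sum_imp_summable[OF hs] by (simp add: integrable_measure_pmf_iff_summable)
    have "(\<integral>\<^sup>+s. emeasure M (act s -` A \<inter> space M) \<partial>p)
        = ennreal (\<integral>s. measure M (act s -` A \<inter> space M) \<partial>p)"
      unfolding emeasure_eq_measure using int by (intro nn_integral_eq_integral) auto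
    also have "\<dots> = emeasure M A"
      using infsumI[OF hs] by (simp add: expectation_pmf_eq_infsum[OF int] emeasure_eq_measure)
    finally show "(\<integral>\<^sup>+s. emeasure M (act s -` A \<inter> space M) \<partial>p) = emeasure M A" .
  qed
  have ent: "nn_entropy p < \<infinity>"
    unfolding nn_entropy_finite_iff pmf_p by (rule assms(5))
  have mom: "integrable (measure_pmf p) (\<lambda>s. ln (1 + L s))"
    unfolding integrable_measure_pmf_iff_summable pmf_p by (rule assms(6))
  obtain d K where K: "0 < K"
    and RD: "\<And>F. finite F \<Longrightarrow> (\<Sum>s\<in>F. (Xi M act s)\<^sup>2 / (1 + L s) ^ (2 * d)) \<le> K"
    using rapid_decay_bound[OF assms(1,2,8)] by blast
  define P where "P = convol_pow_pmf p"
  have pmf_P: "pmf (P n) = conv_pow mu n" for n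
    by (simp add: P_def pmf_convol_pow pmf_p)
  have stat_P: "stationary (P n)" and ent_P: "nn_entropy (P n) < \<infinity>" for n
    unfolding P_def by (intro stationary_convol_pow stat nn_entropy_convol_pow_pmf ent)+
  define h where "h = measure_pmf.expectation p info"
  define H where "H n = shannon_entropy (conv_pow mu n)" for n
  define X where "X n = -2 * (\<Sum>\<^sub>\<infinity>s. conv_pow mu n s * ln (Xi M act s))" for n
  define l where "l n = measure_pmf.expectation (P n) (\<lambda>s. ln (1 + L s))" for n
  have l_int: "integrable (measure_pmf (P n)) (\<lambda>s. ln (1 + L s))" for n
    unfolding P_def by (rule log_moment_convol_pow_pmf(1)[OF assms(1) mom])
  have l_lim: "(\<lambda>n. l n / real n) \<longlonglongrightarrow> 0"
    unfolding P_def l_def by (rule log_moment_convol_pow_pmf(2)[OF assms(1) mom])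
  have info_P: "measure_pmf.expectation (P n) info = real n * h" for n
    unfolding P_def h_def by (rule expectation_info_convol_pow[OF stat ent])
  have ln_P: "integrable (measure_pmf (P n)) (\<lambda>s. - ln (pmf (P n) s))" for n
    unfolding integrable_ln_pmf_iff by (rule ent_P)
  have H_eq: "H n = measure_pmf.expectation (P n) (\<lambda>s. - ln (pmf (P n) s))" for n
    using shannon_entropy_pmf[OF ent_P] by (simp add: H_def pmf_P)
  \<comment> \<open>On the support \<open>Xi\<close> lies in \<open>(0, 1]\<close> and
    \<open>- 2 * ln (Xi M act s)\<close> is at most \<open>info s\<close>, so \<open>info\<close>
    dominates \<open>ln (Xi M act s)\<close> in absolute value.\<close>
  have Xi_int: "integrable (measure_pmf (P n)) (\<lambda>s. ln (Xi M act s))" for n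
  proof (rule Bochner_Integration.integrable_bound[OF integrable_info[OF stat_P ent_P, of n]])
    show "AE s in measure_pmf (P n). norm (ln (Xi M act s)) \<le> norm (info s)"
    proof (rule AE_pmfI)
      fix s assume "s \<in> set_pmf (P n)"
      from Xi_bounds[OF stat_P this] info_nonneg[OF stat_P this]
      show "norm (ln (Xi M act s)) \<le> norm (info s)"
        using ln_le_zero_iff[of "Xi M act s"] by simp
    qed
  qed simp
  have X_eq: "X n = -2 * measure_pmf.expectation (P n) (\<lambda>s. ln (Xi M act s))" for n
    unfolding X_def expectation_pmf_eq_infsum[OF Xi_int] pmf_P ..
  have X_le: "X n \<le> real n * h" for n
  proof -
    have "measure_pmf.expectation (P n) (\<lambda>s. - 2 * ln (Xi M act s)) \<le> measure_pmf.expectation (P n) info"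
      using Xi_int[of n] integrable_info[OF stat_P ent_P, of n] Xi_bounds(2)[OF stat_P[of n]]
      by (intro integral_mono_AE AE_pmfI) auto
    then show ?thesis by (simp add: X_eq info_P)
  qed
  have h_le: "real n * h \<le> H n" for n
  proof -
    have "measure_pmf.expectation (P n) info \<le> measure_pmf.expectation (P n) (\<lambda>s. - ln (pmf (P n) s))"
      using ln_P[of n] integrable_info[OF stat_P ent_P, of n] info_le[OF stat_P[of n]]
      by (intro integral_mono_AE AE_pmfI) auto
    then show ?thesis by (simp add: H_eq info_P)
  qed
  \<comment> \<open>This is the Gibbs inequality for the weight \<open>?q\<close>, whose finite sums
    are at most \<open>K\<close>. Its negative logarithm splits into the \<open>Xi\<close> term and
    \<open>2 * real d\<close> times the logarithmic moment.\<close>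
  have H_le: "H n \<le> X n + 2 * real d * l n + ln K" for n
  proof -
    let ?q = "\<lambda>s. (Xi M act s)\<^sup>2 / (1 + L s) ^ (2 * d)"
    have L_pos: "0 < 1 + L s" for s using length_function_nonneg[OF assms(1), of s] by simp
    \<comment> \<open>Positivity of \<open>Xi\<close> is known on the support of \<open>P n\<close>,
      so the logarithm is split there and the identity is used almost everywhere.\<close>
    have ln_q: "ln (?q s) = 2 * ln (Xi M act s) - 2 * real d * ln (1 + L s)" if "s \<in> set_pmf (P n)" for s
      using Xi_bounds(1)[OF stat_P that] L_pos[of s]
      by (simp add: ln_div ln_realpow)
    have ln_q_AE: "AE s in measure_pmf (P n). ln (?q s) = 2 * ln (Xi M act s) - 2 * real d * ln (1 + L s)"
      by (rule AE_pmfI) (rule ln_q)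
    have int: "integrable (measure_pmf (P n)) (\<lambda>s. 2 * ln (Xi M act s) - 2 * real d * ln (1 + L s))"
      using Xi_int[of n] l_int[of n] by simp
    have int_q: "integrable (measure_pmf (P n)) (\<lambda>s. ln (?q s))"
      using int by (rule integrable_cong_AE_imp) (use ln_q_AE in auto)
    have "H n \<le> measure_pmf.expectation (P n) (\<lambda>s. - ln (?q s)) + ln K"
      unfolding H_eq
    proof (rule gibbs_subprobability[OF ent_P int_q _ _ K])
      show "0 \<le> ?q s" for s using L_pos[of s] by simp
      show "0 < ?q s" if "s \<in> set_pmf (P n)" for s
        using L_pos[of s] Xi_bounds(1)[OF stat_P that] by simp
    qed (rule RD)
    also have "measure_pmf.expectation (P n) (\<lambda>s. - ln (?q s))
        = measure_pmf.expectation (P n) (\<lambda>s. - (2 * ln (Xi M act s) - 2 * real d * ln (1 + L s)))"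
      using ln_q_AE by (intro integral_cong_AE) auto
    also have "\<dots> = X n + 2 * real d * l n"
      using Xi_int[of n] l_int[of n] by (simp add: X_eq l_def)
    finally show ?thesis .
  qed
  define err where "err n = 2 * real d * (l n / real n) + ln K * (1 / real n)" for n
  have "err \<longlonglongrightarrow> 2 * real d * 0 + ln K * 0"
    unfolding err_def by (intro tendsto_intros l_lim lim_1_over_n)
  then have err: "err \<longlonglongrightarrow> 0" by simp
  \<comment> \<open>From \<open>X n \<le> real n * h \<le> H n \<le> X n + real n * err n\<close>,
    both \<open>X n\<close> and \<open>H n\<close> differ from \<open>real n * h\<close> by at most
    \<open>real n * err n\<close>. The restriction to \<open>1 \<le> n\<close> permits dividing by
    \<open>real n\<close>.\<close>
  have bounds: "h - err n \<le> X n / real n" "X n / real n \<le> h"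
    "h \<le> H n / real n" "H n / real n \<le> h + err n" if n: "1 \<le> n" for n
  proof -
    have "(h - err n) * real n = real n * h - (2 * real d * l n + ln K)"
      and "(h + err n) * real n = real n * h + (2 * real d * l n + ln K)"
      using n by (simp_all add: err_def field_simps)
    then show "h - err n \<le> X n / real n" "X n / real n \<le> h" "h \<le> H n / real n" "H n / real n \<le> h + err n"
      using X_le[of n] h_le[of n] H_le[of n] n
      by (simp_all add: pos_le_divide_eq pos_divide_le_eq mult.commute[of h])
  qed
  have ev: "\<forall>\<^sub>F n in sequentially. P n" if "\<And>n. 1 \<le> n \<Longrightarrow> P n" for P :: "nat \<Rightarrow> bool"
    using that by (rule eventually_sequentiallyI)
  have H_lim: "(\<lambda>n. H n / real n) \<longlonglongrightarrow> h"
  proof (rule tendsto_sandwich[OF _ _ tendsto_const])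
    show "(\<lambda>n. h + err n) \<longlonglongrightarrow> h" using tendsto_add[OF tendsto_const err, of h] by simp
  qed (use bounds in \<open>auto intro: ev\<close>)
  have X_lim: "(\<lambda>n. X n / real n) \<longlonglongrightarrow> h"
  proof (rule tendsto_sandwich[OF _ _ _ tendsto_const])
    show "(\<lambda>n. h - err n) \<longlonglongrightarrow> h" using tendsto_diff[OF tendsto_const err, of h] by simp
  qed (use bounds in \<open>auto intro: ev\<close>)
  \<comment> \<open>\<open>lim\<close> in the definition of \<open>avez_entropy\<close> names the
    value only once convergence is established, which \<open>H_lim\<close> provides.\<close>
  have avez: "avez_entropy mu = h"
    unfolding avez_entropy_def using limI[OF H_lim] by (simp add: H_def)
  have "furstenberg_entropy mu M act = h"
    unfolding furstenberg_entropy_def h_def expectation_pmf_eq_infsum[OF integrable_info[OF stat ent]]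
    by (simp add: info_def pmf_p infsum_uminus)
  then show ?thesis
    using H_lim X_lim by (simp add: avez H_def X_def)
qed

end
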